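(* Let $(M_1,F_1)$ and $(M_2,F_2)$ be two Finslerian manifolds and let $f_k:M_k\to(0,\infty)$, $k\in\{1,2\}$, be smooth functions such that ${}_{f_2}F_1\star_{f_1}F_2$ is a convolution Finslerian metric on $M_1\times M_2$. Then ${}_{f_2}F_1\star_{f_1}F_2$ is locally Minkowskian if and only if $F_1$ as well as $F_2$ are locally Minkowskian metrics and the functions $f_k$, $k\in\{1,2\}$, are both nonzero constants.
   Context: A Finslerian metric on a manifold $M$ is a function $F:TM\to[0,\infty)$ that is $C^\infty$ on the slit tangent bundle $\mathring{T}M$, satisfies $F(x,cy)=cF(x,y)$ for all $c>0$, and has Hessian matrix $g_{ij}(x,y)=\frac12\frac{\partial^2F^2}{\partial y^i\partial y^j}(x,y)$ positive-definite at every point of $\mathring{T}M$. For a product $M=M_1\times M_2$ the slit tangent bundle is $\mathring{T}M=\{(x_1,x_2,y_1,y_2)\in TM: y_1\neq 0,\ y_2\neq 0\}$; on each factor $\mathring{T}M_k$ is $TM_k$ without the zero section. A Finslerian metric $F$ on $M$ is locally Minkowskian (a locally Minkowski metric) if for every $x\in M$ there exists a neighborhood $V$ of $x$ (with local coordinates) on which the components of the Hessian matrix satisfy $g_{ij}(x,y)=g_{ij}(y)$, i.e. do not depend on the base point. Gradient: for a smooth function $u$ on a Finslerian manifold with Hessian matrix $g$, $\nabla u=g^{ij}(x,y)\frac{\partial u}{\partial x^i}\frac{\partial}{\partial x^j}$. Convolution: let $\dim M_1=n_1$, $\dim M_2=n_2$, $n=n_1+n_2$. The Finslerian convolution of $F_1$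 and $F_2$ via $f_1,f_2$ is $F={}_{f_2}F_1\star_{f_1}F_2:T(M_1\times M_2)\to(0,\infty)$ given by $$F^2=f_2^2F_1^2+f_1^2F_2^2+\tfrac12 f_1f_2\,\frac{\partial F_1^2}{\partial y^i}\frac{\partial F_2^2}{\partial y^j}(\nabla f_1)^i(\nabla f_2)^j,$$ where $F_k,f_k$ are pulled back to $M_1\times M_2$ by the projections, $\nabla f_k$ is the gradient with respect to $F_k$, and repeated indices are summed. Associated matrix: in local coordinates $(x_1^1,\dots,x_1^{n_1},x_2^{n_1+1},\dots,x_2^n)$ the matrix associated with $F$ is $$\begin{pmatrix} f_2^2\,(g_{1\alpha\beta}) & 2f_1f_2\left(\frac{\partial f_1}{\partial x_1^\alpha}\frac{\partial f_2}{\partial x_2^\nu}\right)\\ (0) & f_1^2\,(g_{2\mu\nu})\end{pmatrix},\qquad \alpha,\beta\in\{1,\dots,n_1\},\ \mu,\nu\in\{n_1+1,\dots,n\},$$ where $g_1,g_2$ are the Hessian matrices of $F_1,F_2$. ${}_{f_2}F_1\star_{f_1}F_2$ is called a convolution Finslerian metric when this matrix is positive-definite and symmetric on $\mathring{T}(M_1\times M_2)$ (so that it defines a Finslerian metric on $M_1\times M_2$).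
   Formalization: Manifolds are taken connected, and the convolution's being locally Minkowskian is tested only in product coordinates; otherwise the claim fails (f_k only locally constant; flat plane r²dθ²+dr² with f_2=r). *)

theory Defs
  imports "HOL-Analysis.Analysis"
begin

section \<open>Smooth maps between open subsets of Euclidean spaces\<close>

primrec Ck_on ::
  "nat \<Rightarrow> 'a::real_normed_vector set \<Rightarrow> ('a \<Rightarrow> 'b::real_normed_vector) \<Rightarrow> bool" where
  "Ck_on 0 S f \<longleftrightarrow> continuous_on S f"
| "Ck_on (Suc k) S f \<longleftrightarrow>
     (\<forall>x\<in>S. f differentiable (at x)) \<and>
     (\<forall>v. Ck_on k S (\<lambda>x. frechet_derivative f (at x) v))"

text \<open>Only meant for open \<open>S\<close>: derivatives are taken in the whole space.\<close>

definition smooth_on ::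
  "'a::real_normed_vector set \<Rightarrow> ('a \<Rightarrow> 'b::real_normed_vector) \<Rightarrow> bool" where
  "smooth_on S f \<longleftrightarrow> (\<forall>k. Ck_on k S f)"

definition partial :: "'n::finite \<Rightarrow> (real ^ 'n \<Rightarrow> real) \<Rightarrow> real ^ 'n \<Rightarrow> real" where
  "partial i h x = deriv (\<lambda>t. h (x + t *\<^sub>R axis i 1)) 0"


section \<open>Smooth manifolds\<close>

text \<open>A chart is a pair of its domain and its coordinate map; the values of the coordinate map
  outside the domain are irrelevant.\<close>

type_synonym ('a, 'n) chart = "'a set \<times> ('a \<Rightarrow> real ^ 'n)"

definition is_chart :: "'a topology \<Rightarrow> ('a, 'n::finite) chart \<Rightarrow> bool" where
  "is_chart M c \<longleftrightarrow>
     openin M (fst c) \<and> open (snd c ` fst c) \<and>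
     homeomorphic_map (subtopology M (fst c)) (top_of_set (snd c ` fst c)) (snd c)"

definition chart_inv :: "('a, 'n::finite) chart \<Rightarrow> real ^ 'n \<Rightarrow> 'a" where
  "chart_inv c = inv_into (fst c) (snd c)"

definition transition ::
  "('a, 'n::finite) chart \<Rightarrow> ('a, 'n) chart \<Rightarrow> real ^ 'n \<Rightarrow> real ^ 'n" where
  "transition c d = snd d \<circ> chart_inv c"

definition compatible :: "('a, 'n::finite) chart \<Rightarrow> ('a, 'n) chart \<Rightarrow> bool" where
  "compatible c d \<longleftrightarrow>
     smooth_on (snd c ` (fst c \<inter> fst d)) (transition c d) \<and>
     smooth_on (snd d ` (fst c \<inter> fst d)) (transition d c)"

text \<open>Manifolds are nonempty, connected, Hausdorff and second countable, and carry a maximal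
  smooth atlas; the dimension is \<open>CARD('n)\<close>.\<close>

definition smooth_manifold :: "'a topology \<Rightarrow> ('a, 'n::finite) chart set \<Rightarrow> bool" where
  "smooth_manifold M A \<longleftrightarrow>
     topspace M \<noteq> {} \<and> connected_space M \<and> Hausdorff_space M \<and> second_countable M \<and>
     (\<forall>c\<in>A. is_chart M c) \<and>
     (\<Union>c\<in>A. fst c) = topspace M \<and>
     (\<forall>c\<in>A. \<forall>d\<in>A. compatible c d) \<and>
     (\<forall>c. is_chart M c \<and> (\<forall>d\<in>A. compatible c d) \<longrightarrow> c \<in> A)"

definition smooth_function :: "('a, 'n::finite) chart set \<Rightarrow> ('a \<Rightarrow> real) \<Rightarrow> bool" where
  "smooth_function A u \<longleftrightarrow> (\<forall>c\<in>A. smooth_on (snd c ` fst c) (u \<circ> chart_inv c))"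


section \<open>Tangent vectors\<close>

text \<open>A tangent vector is its base point together with the family of its component vectors in
  all charts around that point, any two of which are related by the Jacobian of the transition
  map.  The family is \<open>0\<close> at charts that do not contain the base point.\<close>

type_synonym ('a, 'n) tvector = "'a \<times> (('a, 'n) chart \<Rightarrow> real ^ 'n)"

text \<open>The tangent vector at \<open>p\<close> with components \<open>y\<close> in the chart \<open>c\<close>.\<close>

definition tangent ::
  "('a, 'n::finite) chart set \<Rightarrow> ('a, 'n) chart \<Rightarrow> 'a \<Rightarrow> real ^ 'n \<Rightarrow> ('a, 'n) tvector" where
  "tangent A c p y =
     (p, \<lambda>d. if d \<in> A \<and> p \<in> fst d
             then frechet_derivative (transition c d) (at (snd c p)) y else 0)"

definition tangent_bundle :: "('a, 'n::finite) chart set \<Rightarrow> ('a, 'n) tvector set" where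
  "tangent_bundle A = {tangent A c p y | c p y. c \<in> A \<and> p \<in> fst c}"

definition slit_bundle :: "('a, 'n::finite) chart set \<Rightarrow> ('a, 'n) tvector set" where
  "slit_bundle A = {w \<in> tangent_bundle A. snd w \<noteq> (\<lambda>_. 0)}"

definition some_chart :: "('a, 'n::finite) chart set \<Rightarrow> 'a \<Rightarrow> ('a, 'n) chart" where
  "some_chart A p = (SOME c. c \<in> A \<and> p \<in> fst c)"

text \<open>The differential of a smooth map \<open>h\<close>.  By the chain rule the result does not depend on
  the chart chosen in the source.\<close>

definition tangent_map ::
  "('a, 'm::finite) chart set \<Rightarrow> ('b, 'n::finite) chart set \<Rightarrow> ('a \<Rightarrow> 'b)
     \<Rightarrow> ('a, 'm) tvector \<Rightarrow> ('b, 'n) tvector" where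
  "tangent_map A B h w =
     (let c = some_chart A (fst w) in
      (h (fst w), \<lambda>d. if d \<in> B \<and> h (fst w) \<in> fst d
        then frechet_derivative (snd d \<circ> h \<circ> chart_inv c) (at (snd c (fst w))) (snd w c)
        else 0))"


section \<open>Finslerian metrics\<close>

definition positive_definite :: "real ^ 'n ^ 'n \<Rightarrow> bool" where
  "positive_definite B \<longleftrightarrow> (\<forall>v. v \<noteq> 0 \<longrightarrow> v \<bullet> (B *v v) > 0)"

definition symmetric_matrix :: "real ^ 'n ^ 'n \<Rightarrow> bool" where
  "symmetric_matrix B \<longleftrightarrow> transpose B = B"

text \<open>The function \<open>F(x,y)\<close> of the coordinates in a chart.\<close>

definition local_rep ::
  "('a, 'n::finite) chart set \<Rightarrow> (('a, 'n) tvector \<Rightarrow> real) \<Rightarrow> ('a, 'n) chart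
     \<Rightarrow> real ^ 'n \<Rightarrow> real ^ 'n \<Rightarrow> real" where
  "local_rep A F c x y = F (tangent A c (chart_inv c x) y)"

definition hessian_matrix ::
  "('a, 'n::finite) chart set \<Rightarrow> (('a, 'n) tvector \<Rightarrow> real) \<Rightarrow> ('a, 'n) chart
     \<Rightarrow> real ^ 'n \<Rightarrow> real ^ 'n \<Rightarrow> real ^ 'n ^ 'n" where
  "hessian_matrix A F c x y =
     (\<chi> i j. (1/2) * partial i (partial j (\<lambda>z. (local_rep A F c x z)\<^sup>2)) y)"

definition finsler_metric ::
  "('a, 'n::finite) chart set \<Rightarrow> (('a, 'n) tvector \<Rightarrow> real) \<Rightarrow> bool" where
  "finsler_metric A F \<longleftrightarrow>
     (\<forall>w\<in>tangent_bundle A. F w \<ge> 0) \<and>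
     (\<forall>c\<in>A. smooth_on ((snd c ` fst c) \<times> (- {0})) (\<lambda>(x, y). local_rep A F c x y)) \<and>
     (\<forall>w\<in>tangent_bundle A. \<forall>r>0. F (fst w, \<lambda>d. r *\<^sub>R snd w d) = r * F w) \<and>
     (\<forall>w\<in>slit_bundle A. \<forall>c\<in>A. fst w \<in> fst c \<longrightarrow>
        positive_definite (hessian_matrix A F c (snd c (fst w)) (snd w c)))"

text \<open>\<open>A\<close> is the set of admissible local coordinate systems and \<open>S\<close> the slit tangent bundle on
  which the Hessian matrix is considered.  The neighbourhood of \<open>p\<close> is the domain of the
  chart.\<close>

definition locally_minkowskian ::
  "'a topology \<Rightarrow> ('a, 'n::finite) chart set \<Rightarrow> ('a, 'n) tvector set
     \<Rightarrow> (('a, 'n) tvector \<Rightarrow> real) \<Rightarrow> bool" where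
  "locally_minkowskian M A S F \<longleftrightarrow>
     (\<forall>p\<in>topspace M. \<exists>c\<in>A. p \<in> fst c \<and>
        (\<exists>g. \<forall>w\<in>S. fst w \<in> fst c \<longrightarrow>
               hessian_matrix A F c (snd c (fst w)) (snd w c) = g (snd w c)))"

text \<open>Components in the chart \<open>c\<close> of the gradient of \<open>u\<close> with respect to \<open>F\<close>.\<close>

definition gradient ::
  "('a, 'n::finite) chart set \<Rightarrow> (('a, 'n) tvector \<Rightarrow> real) \<Rightarrow> ('a \<Rightarrow> real)
     \<Rightarrow> ('a, 'n) chart \<Rightarrow> real ^ 'n \<Rightarrow> real ^ 'n \<Rightarrow> real ^ 'n" where
  "gradient A F u c x y =
     (\<chi> i. \<Sum>j\<in>UNIV. matrix_inv (hessian_matrix A F c x y) $ i $ j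
                      * partial j (u \<circ> chart_inv c) x)"


section \<open>Products\<close>

definition join_vec :: "real ^ 'm \<Rightarrow> real ^ 'n \<Rightarrow> real ^ ('m::finite + 'n::finite)" where
  "join_vec x y = (\<chi> k. case k of Inl i \<Rightarrow> x $ i | Inr j \<Rightarrow> y $ j)"

definition prod_chart ::
  "('a, 'm::finite) chart \<Rightarrow> ('b, 'n::finite) chart \<Rightarrow> ('a \<times> 'b, 'm + 'n) chart" where
  "prod_chart c d = (fst c \<times> fst d, \<lambda>(p, q). join_vec (snd c p) (snd d q))"

text \<open>The local coordinates used on a product are the product coordinates
  \<open>(x\<^sub>1, x\<^sub>2)\<close>; this atlas is deliberately not enlarged to a maximal one.  With arbitrary
  coordinates on the product, the characterization of locally Minkowskian convolutions by
  constancy of \<open>f\<^sub>1, f\<^sub>2\<close> fails: the flat plane in polar coordinates is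
  \<open>r\<^sup>2 d\<theta>\<^sup>2 + dr\<^sup>2\<close>.\<close>

definition prod_atlas ::
  "('a, 'm::finite) chart set \<Rightarrow> ('b, 'n::finite) chart set \<Rightarrow> ('a \<times> 'b, 'm + 'n) chart set" where
  "prod_atlas A1 A2 = {prod_chart c1 c2 | c1 c2. c1 \<in> A1 \<and> c2 \<in> A2}"

definition tproj1 ::
  "('a, 'm::finite) chart set \<Rightarrow> ('b, 'n::finite) chart set
     \<Rightarrow> ('a \<times> 'b, 'm + 'n) tvector \<Rightarrow> ('a, 'm) tvector" where
  "tproj1 A1 A2 = tangent_map (prod_atlas A1 A2) A1 fst"

definition tproj2 ::
  "('a, 'm::finite) chart set \<Rightarrow> ('b, 'n::finite) chart set
     \<Rightarrow> ('a \<times> 'b, 'm + 'n) tvector \<Rightarrow> ('b, 'n) tvector" where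
  "tproj2 A1 A2 = tangent_map (prod_atlas A1 A2) A2 snd"

text \<open>Both components have to be nonzero; this is smaller than \<open>slit_bundle (prod_atlas A1 A2)\<close>.\<close>

definition prod_slit_bundle ::
  "('a, 'm::finite) chart set \<Rightarrow> ('b, 'n::finite) chart set
     \<Rightarrow> ('a \<times> 'b, 'm + 'n) tvector set" where
  "prod_slit_bundle A1 A2 =
     {w \<in> tangent_bundle (prod_atlas A1 A2).
        tproj1 A1 A2 w \<in> slit_bundle A1 \<and> tproj2 A1 A2 w \<in> slit_bundle A2}"


section \<open>Convolution\<close>

text \<open>The double sum is the contraction of tensors, so its value does not depend on the charts
  in which the components are computed.\<close>

definition convolution ::
  "('a, 'm::finite) chart set \<Rightarrow> (('a, 'm) tvector \<Rightarrow> real) \<Rightarrow> ('a \<Rightarrow> real) \<Rightarrow>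
   ('b, 'n::finite) chart set \<Rightarrow> (('b, 'n) tvector \<Rightarrow> real) \<Rightarrow> ('b \<Rightarrow> real) \<Rightarrow>
   ('a \<times> 'b, 'm + 'n) tvector \<Rightarrow> real" where
  "convolution A1 F1 f1 A2 F2 f2 w =
     (let w1 = tproj1 A1 A2 w; w2 = tproj2 A1 A2 w;
          c1 = some_chart A1 (fst w1); c2 = some_chart A2 (fst w2);
          x1 = snd c1 (fst w1); y1 = snd w1 c1;
          x2 = snd c2 (fst w2); y2 = snd w2 c2
      in sqrt ((f2 (fst w2))\<^sup>2 * (F1 w1)\<^sup>2 + (f1 (fst w1))\<^sup>2 * (F2 w2)\<^sup>2
           + (1/2) * f1 (fst w1) * f2 (fst w2) *
             (\<Sum>i\<in>UNIV. \<Sum>j\<in>UNIV.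
                partial i (\<lambda>z. (local_rep A1 F1 c1 x1 z)\<^sup>2) y1 *
                partial j (\<lambda>z. (local_rep A2 F2 c2 x2 z)\<^sup>2) y2 *
                gradient A1 F1 f1 c1 x1 y1 $ i * gradient A2 F2 f2 c2 x2 y2 $ j)))"

text \<open>The matrix associated with the convolution at \<open>w\<close>, in the coordinates given by \<open>c1\<close> and
  \<open>c2\<close>.\<close>

definition associated_matrix ::
  "('a, 'm::finite) chart set \<Rightarrow> (('a, 'm) tvector \<Rightarrow> real) \<Rightarrow> ('a \<Rightarrow> real) \<Rightarrow>
   ('b, 'n::finite) chart set \<Rightarrow> (('b, 'n) tvector \<Rightarrow> real) \<Rightarrow> ('b \<Rightarrow> real) \<Rightarrow>
   ('a, 'm) chart \<Rightarrow> ('b, 'n) chart \<Rightarrow> ('a \<times> 'b, 'm + 'n) tvector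
     \<Rightarrow> real ^ ('m + 'n) ^ ('m + 'n)" where
  "associated_matrix A1 F1 f1 A2 F2 f2 c1 c2 w =
     (let w1 = tproj1 A1 A2 w; w2 = tproj2 A1 A2 w;
          x1 = snd c1 (fst w1); y1 = snd w1 c1;
          x2 = snd c2 (fst w2); y2 = snd w2 c2
      in \<chi> k l. case k of
           Inl a \<Rightarrow> (case l of
               Inl b \<Rightarrow> (f2 (fst w2))\<^sup>2 * hessian_matrix A1 F1 c1 x1 y1 $ a $ b
             | Inr n \<Rightarrow> 2 * f1 (fst w1) * f2 (fst w2)
                         * (partial a (f1 \<circ> chart_inv c1) x1 * partial n (f2 \<circ> chart_inv c2) x2))
         | Inr m \<Rightarrow> (case l of
               Inl b \<Rightarrow> 0
             | Inr n \<Rightarrow> (f1 (fst w1))\<^sup>2 * hessian_matrix A2 F2 c2 x2 y2 $ m $ n))"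

definition convolution_finsler_metric ::
  "('a, 'm::finite) chart set \<Rightarrow> (('a, 'm) tvector \<Rightarrow> real) \<Rightarrow> ('a \<Rightarrow> real) \<Rightarrow>
   ('b, 'n::finite) chart set \<Rightarrow> (('b, 'n) tvector \<Rightarrow> real) \<Rightarrow> ('b \<Rightarrow> real) \<Rightarrow> bool" where
  "convolution_finsler_metric A1 F1 f1 A2 F2 f2 \<longleftrightarrow>
     (\<forall>w\<in>prod_slit_bundle A1 A2. \<forall>c1\<in>A1. \<forall>c2\<in>A2. fst w \<in> fst c1 \<times> fst c2 \<longrightarrow>
        positive_definite (associated_matrix A1 F1 f1 A2 F2 f2 c1 c2 w) \<and>
        symmetric_matrix (associated_matrix A1 F1 f1 A2 F2 f2 c1 c2 w))"

end

theory Submission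
  imports Defs
begin

text \<open>
  The associated matrix has a zero block below the diagonal, so its symmetry says that
  \<open>f\<^sub>1 f\<^sub>2 (\<partial>f\<^sub>1/\<partial>x\<^sup>\<alpha>) (\<partial>f\<^sub>2/\<partial>x\<^sup>\<nu>) = 0\<close> for all \<open>\<alpha>\<close>, \<open>\<nu>\<close>
  (\<open>convolution_finsler_metric_partials\<close>).  The mixed term of the convolution is a linear
  combination of exactly these products, whatever the coefficients
  \<open>g\<^sub>1\<^sup>i\<^sup>k\<close>, \<open>g\<^sub>2\<^sup>j\<^sup>l\<close> of the gradients are.  Hence it vanishes, and the convolution is the doubly
  warped product \<open>F\<^sup>2 = f\<^sub>2\<^sup>2 F\<^sub>1\<^sup>2 + f\<^sub>1\<^sup>2 F\<^sub>2\<^sup>2\<close> (\<open>convolution_squared\<close>).  In product coordinates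
  its Hessian matrix is therefore block diagonal with blocks \<open>f\<^sub>2\<^sup>2 g\<^sub>1\<close> and \<open>f\<^sub>1\<^sup>2 g\<^sub>2\<close>
  (\<open>hessian_matrix_convolution\<close>).

  If \<open>F\<close> is locally Minkowskian, then on the domain of a suitable product chart
  \<open>f\<^sub>2(x\<^sub>2)\<^sup>2 g\<^sub>1(x\<^sub>1, y\<^sub>1)\<close> depends on \<open>y\<^sub>1\<close> only.  Moving \<open>x\<^sub>2\<close> alone, and using that the positive
  definite matrix \<open>g\<^sub>1\<close> is nonzero, makes \<open>f\<^sub>2\<close> locally constant; then \<open>g\<^sub>1\<close> does not depend on \<open>x\<^sub>1\<close>.
  The other block gives the same for \<open>f\<^sub>1\<close> and \<open>g\<^sub>2\<close>, and connectedness of the factors makes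
  \<open>f\<^sub>1\<close>, \<open>f\<^sub>2\<close> constant.  Conversely, if \<open>f\<^sub>1\<close>, \<open>f\<^sub>2\<close> are constant and each \<open>g\<^sub>k\<close> depends on \<open>y\<^sub>k\<close> only in
  a chart of its factor, then both blocks depend on \<open>(y\<^sub>1, y\<^sub>2)\<close> only in the product of these
  charts.

  What remains is to relate the chart-free objects to coordinates: a tangent vector is
  recovered from its components in any chart (\<open>tangent_bundle_in_chart\<close>), and the two
  projections of a tangent vector of the product are the two parts of its component vector
  (\<open>tproj_tangent\<close>).\<close>

section \<open>Differentiable atlases and components of tangent vectors\<close>

text \<open>The part of the structure of an atlas on which the calculus of components rests.  Unlike
  maximality, it is inherited by the atlas of product charts.\<close>

definition differentiable_atlas :: "('a, 'n::finite) chart set \<Rightarrow> bool" where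
  "differentiable_atlas A \<longleftrightarrow>
     (\<forall>c\<in>A. inj_on (snd c) (fst c)) \<and>
     (\<forall>c\<in>A. \<forall>d\<in>A. open (snd c ` (fst c \<inter> fst d)) \<and>
        (\<forall>p\<in>fst c \<inter> fst d. transition c d differentiable (at (snd c p))))"

lemma differentiable_atlasD:
  assumes "differentiable_atlas A" "c \<in> A" "d \<in> A"
  shows "inj_on (snd c) (fst c)"
    and "open (snd c ` (fst c \<inter> fst d))"
    and "p \<in> fst c \<Longrightarrow> p \<in> fst d \<Longrightarrow> transition c d differentiable (at (snd c p))"
  using assms unfolding differentiable_atlas_def by auto

lemma smooth_on_imp_differentiable:
  "smooth_on S f \<Longrightarrow> x \<in> S \<Longrightarrow> f differentiable (at x)"
  unfolding smooth_on_def by (metis Ck_on.simps(2))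

lemma smooth_on_frechet_derivative_differentiable:
  "smooth_on S f \<Longrightarrow> x \<in> S \<Longrightarrow> (\<lambda>x. frechet_derivative f (at x) v) differentiable (at x)"
  unfolding smooth_on_def by (metis Ck_on.simps(2))

lemma smooth_manifold_imp_differentiable_atlas:
  fixes M :: "'a topology" and A :: "('a, 'n::finite) chart set"
  assumes "smooth_manifold M A"
  shows "differentiable_atlas A"
  unfolding differentiable_atlas_def
proof (intro conjI ballI)
  fix c assume "c \<in> A"
  then have "is_chart M c" using assms unfolding smooth_manifold_def by blast
  then have h: "homeomorphic_map (subtopology M (fst c)) (top_of_set (snd c ` fst c)) (snd c)"
    and o: "openin M (fst c)" and oi: "open (snd c ` fst c)"
    unfolding is_chart_def by auto
  have ts: "topspace (subtopology M (fst c)) = fst c"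
    using o openin_subset by fastforce
  show "inj_on (snd c) (fst c)"
    using h ts homeomorphic_imp_injective_map by metis
  fix d assume "d \<in> A"
  then have od: "openin M (fst d)"
    using assms unfolding smooth_manifold_def is_chart_def by blast
  have "openin (subtopology M (fst c)) (fst c \<inter> fst d)"
    using od by (simp add: openin_subtopology_Int2)
  then have "openin (top_of_set (snd c ` fst c)) (snd c ` (fst c \<inter> fst d))"
    using homeomorphic_map_openness[OF h, of "fst c \<inter> fst d"] ts by blast
  then show "open (snd c ` (fst c \<inter> fst d))"
    using oi openin_open_trans by blast
  fix p assume "p \<in> fst c \<inter> fst d"
  moreover have "compatible c d"
    using assms \<open>c \<in> A\<close> \<open>d \<in> A\<close> unfolding smooth_manifold_def by blast
  ultimately show "transition c d differentiable (at (snd c p))"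
    unfolding compatible_def by (auto intro: smooth_on_imp_differentiable)
qed

lemma chart_inv_chart:
  "inj_on (snd c) (fst c) \<Longrightarrow> p \<in> fst c \<Longrightarrow> chart_inv c (snd c p) = p"
  unfolding chart_inv_def by simp

lemma transition_derivative:
  assumes "differentiable_atlas A" "c \<in> A" "d \<in> A" "p \<in> fst c" "p \<in> fst d"
  shows "(transition c d has_derivative frechet_derivative (transition c d) (at (snd c p)))
           (at (snd c p))"
  using differentiable_atlasD(3)[OF assms] frechet_derivative_works by blast

lemma transition_chart:
  "inj_on (snd c) (fst c) \<Longrightarrow> p \<in> fst c \<Longrightarrow> transition c d (snd c p) = snd d p"
  unfolding transition_def by (simp add: chart_inv_chart)

text \<open>The cocycle identity of the transition maps, differentiated.\<close>

lemma transition_derivative_cocycle: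
  assumes A: "differentiable_atlas A" and c: "c \<in> A" "p \<in> fst c" and d: "d \<in> A" "p \<in> fst d"
    and e: "e \<in> A" "p \<in> fst e"
  shows "frechet_derivative (transition d e) (at (snd d p))
           (frechet_derivative (transition c d) (at (snd c p)) y) =
         frechet_derivative (transition c e) (at (snd c p)) y"
proof -
  note inj = differentiable_atlasD(1)[OF A c(1) c(1)] differentiable_atlasD(1)[OF A d(1) d(1)]
  have "(transition d e \<circ> transition c d has_derivative
          frechet_derivative (transition d e) (at (snd d p)) \<circ>
          frechet_derivative (transition c d) (at (snd c p))) (at (snd c p))"
    using diff_chain_at[OF transition_derivative[OF A c(1) d(1) c(2) d(2)]]
      transition_derivative[OF A d(1) e(1) d(2) e(2)] transition_chart[OF inj(1) c(2)] by metis
  then have "(transition c e has_derivative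
          frechet_derivative (transition d e) (at (snd d p)) \<circ>
          frechet_derivative (transition c d) (at (snd c p))) (at (snd c p))"
  proof (rule has_derivative_transform_within_open[OF _ differentiable_atlasD(2)[OF A c(1) d(1)]])
    show "snd c p \<in> snd c ` (fst c \<inter> fst d)" using c d by blast
    show "(transition d e \<circ> transition c d) x = transition c e x"
      if "x \<in> snd c ` (fst c \<inter> fst d)" for x
      using that by (auto simp: transition_chart inj)
  qed
  from frechet_derivative_at[OF this] show ?thesis by (metis comp_apply)
qed

lemma transition_self_derivative:
  assumes A: "differentiable_atlas A" and c: "c \<in> A" "p \<in> fst c"
  shows "frechet_derivative (transition c c) (at (snd c p)) y = y"
proof -
  note inj = differentiable_atlasD(1)[OF A c(1) c(1)]
  have "((\<lambda>x. x) has_derivative (\<lambda>x. x)) (at (snd c p))" by simp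
  then have "(transition c c has_derivative (\<lambda>x. x)) (at (snd c p))"
  proof (rule has_derivative_transform_within_open[OF _ differentiable_atlasD(2)[OF A c(1) c(1)]])
    show "snd c p \<in> snd c ` (fst c \<inter> fst c)" using c by blast
    show "x = transition c c x" if "x \<in> snd c ` (fst c \<inter> fst c)" for x
      using that by (auto simp: transition_chart inj)
  qed
  from frechet_derivative_at[OF this] show ?thesis by metis
qed

lemma fst_tangent [simp]: "fst (tangent A c p y) = p"
  by (simp add: tangent_def)

lemma tangent_components:
  assumes "differentiable_atlas A" "c \<in> A" "p \<in> fst c"
  shows "snd (tangent A c p y) c = y"
  using assms by (simp add: tangent_def transition_self_derivative)

text \<open>The base chart in \<open>tangent\<close> is immaterial: the cocycle identity turns the components in
  one chart into those in another.\<close>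

lemma tangent_change_chart:
  assumes "differentiable_atlas A" "c \<in> A" "p \<in> fst c" "d \<in> A" "p \<in> fst d"
  shows "tangent A d p (snd (tangent A c p y) d) = tangent A c p y"
  using assms by (auto simp: tangent_def transition_derivative_cocycle)

lemma tangent_bundle_in_chart:
  assumes "differentiable_atlas A" "w \<in> tangent_bundle A" "c \<in> A" "fst w \<in> fst c"
  shows "w = tangent A c (fst w) (snd w c)"
proof -
  obtain d p y where "w = tangent A d p y" "d \<in> A" "p \<in> fst d"
    using assms(2) unfolding tangent_bundle_def by blast
  then show ?thesis using tangent_change_chart[of A d p c y] assms by auto
qed

lemma tangent_in_slit_bundle_iff:
  assumes "differentiable_atlas A" "c \<in> A" "p \<in> fst c"
  shows "tangent A c p y \<in> slit_bundle A \<longleftrightarrow> y \<noteq> 0"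
proof -
  have "tangent A c p y \<in> tangent_bundle A"
    using assms unfolding tangent_bundle_def by blast
  moreover have "snd (tangent A c p 0) = (\<lambda>_. 0)"
    using has_derivative_linear[OF transition_derivative[OF assms(1,2) _ assms(3)]]
    by (auto simp: tangent_def linear_0)
  moreover have "snd (tangent A c p y) \<noteq> (\<lambda>_. 0)" if "y \<noteq> 0"
    using tangent_components[OF assms, of y] that by metis
  ultimately show ?thesis unfolding slit_bundle_def by auto
qed

section \<open>Product charts\<close>

definition left_part :: "real ^ ('m::finite + 'n::finite) \<Rightarrow> real ^ 'm" where
  "left_part z = (\<chi> i. z $ Inl i)"

definition right_part :: "real ^ ('m::finite + 'n::finite) \<Rightarrow> real ^ 'n" where
  "right_part z = (\<chi> i. z $ Inr i)"

lemma parts_join_vec [simp]: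
  "left_part (join_vec x y) = x" "right_part (join_vec x y) = y"
  "join_vec (left_part z) (right_part z) = z"
  by (auto simp: left_part_def right_part_def join_vec_def vec_eq_iff split: sum.split)

lemma linear_parts: "linear left_part" "linear right_part"
  by (auto intro!: linearI simp: left_part_def right_part_def vec_eq_iff)

lemma bounded_linear_parts: "bounded_linear left_part" "bounded_linear right_part"
  using linear_parts by (simp_all add: linear_conv_bounded_linear)

lemma parts_axis [simp]:
  "left_part (axis (Inl i) 1) = axis i 1" "right_part (axis (Inl i) 1) = 0"
  "left_part (axis (Inr j) 1) = 0" "right_part (axis (Inr j) 1) = axis j 1"
  by (auto simp: left_part_def right_part_def axis_def vec_eq_iff)

lemma parts_add_scale [simp]:
  "left_part (x + t *\<^sub>R y) = left_part x + t *\<^sub>R left_part y"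
  "right_part (x + t *\<^sub>R y) = right_part x + t *\<^sub>R right_part y"
  by (simp_all add: linear_parts linear_add linear_scale)

lemma has_derivative_join_vec:
  assumes "(f has_derivative f') (at x)" "(g has_derivative g') (at x)"
  shows "((\<lambda>x. join_vec (f x) (g x)) has_derivative (\<lambda>x. join_vec (f' x) (g' x))) (at x)"
proof -
  have "linear (\<lambda>z. join_vec (fst z) (snd z))"
    by (auto intro!: linearI simp: join_vec_def vec_eq_iff split: sum.split)
  then have "bounded_linear (\<lambda>z. join_vec (fst z) (snd z))"
    by (simp add: linear_conv_bounded_linear)
  from bounded_linear.has_derivative[OF this has_derivative_Pair[OF assms]]
  show ?thesis by simp
qed

lemma prod_chart_simps [simp]:
  "fst (prod_chart c d) = fst c \<times> fst d"
  "snd (prod_chart c d) (p, q) = join_vec (snd c p) (snd d q)"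
  by (simp_all add: prod_chart_def)

lemma prod_atlasE:
  assumes "c \<in> prod_atlas A1 A2"
  obtains c1 c2 where "c = prod_chart c1 c2" "c1 \<in> A1" "c2 \<in> A2"
  using assms unfolding prod_atlas_def by blast

lemma prod_chart_in_prod_atlas: "c1 \<in> A1 \<Longrightarrow> c2 \<in> A2 \<Longrightarrow> prod_chart c1 c2 \<in> prod_atlas A1 A2"
  unfolding prod_atlas_def by blast

lemma inj_on_prod_chart:
  assumes "inj_on (snd c1) (fst c1)" "inj_on (snd c2) (fst c2)"
  shows "inj_on (snd (prod_chart c1 c2)) (fst (prod_chart c1 c2))"
proof (rule inj_onI)
  fix u v
  assume *: "u \<in> fst (prod_chart c1 c2)" "v \<in> fst (prod_chart c1 c2)"
    "snd (prod_chart c1 c2) u = snd (prod_chart c1 c2) v"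
  obtain p q p' q' where uv: "u = (p, q)" "v = (p', q')" by fastforce
  with *(3) have "snd c1 p = snd c1 p'" "snd c2 q = snd c2 q'"
    by (metis parts_join_vec prod_chart_simps(2))+
  with * uv assms show "u = v" by (auto dest: inj_onD)
qed

lemma prod_chart_image:
  "snd (prod_chart c1 c2) ` (U \<times> V) = left_part -` (snd c1 ` U) \<inter> right_part -` (snd c2 ` V)"
proof (intro equalityI subsetI)
  fix z assume "z \<in> left_part -` (snd c1 ` U) \<inter> right_part -` (snd c2 ` V)"
  then obtain p q where "left_part z = snd c1 p" "p \<in> U" "right_part z = snd c2 q" "q \<in> V"
    by auto
  then have "z = snd (prod_chart c1 c2) (p, q)" by (metis parts_join_vec(3) prod_chart_simps(2))
  then show "z \<in> snd (prod_chart c1 c2) ` (U \<times> V)" using \<open>p \<in> U\<close> \<open>q \<in> V\<close> by blast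
qed auto

lemma open_prod_chart_image:
  assumes "open (snd c1 ` U)" "open (snd c2 ` V)"
  shows "open (snd (prod_chart c1 c2) ` (U \<times> V))"
  unfolding prod_chart_image using assms bounded_linear_parts
  by (intro open_Int continuous_open_vimage) (auto intro: linear_continuous_at)

text \<open>On the image of a product chart the transition map is the product of the transition maps
  of the factors.  Elsewhere it is an arbitrary function, but that image is open, so the
  derivative is not affected.\<close>

lemma prod_transition_derivative:
  assumes A1: "differentiable_atlas A1" and A2: "differentiable_atlas A2"
    and c1: "c1 \<in> A1" "p \<in> fst c1" and c2: "c2 \<in> A2" "q \<in> fst c2"
    and d1: "d1 \<in> A1" "p \<in> fst d1" and d2: "d2 \<in> A2" "q \<in> fst d2"
  shows "(transition (prod_chart c1 c2) (prod_chart d1 d2) has_derivative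
           (\<lambda>v. join_vec (frechet_derivative (transition c1 d1) (at (snd c1 p)) (left_part v))
                         (frechet_derivative (transition c2 d2) (at (snd c2 q)) (right_part v))))
           (at (join_vec (snd c1 p) (snd c2 q)))" (is "(_ has_derivative ?D) (at ?x)")
proof -
  note inj1 = differentiable_atlasD(1)[OF A1 c1(1) c1(1)]
  note inj2 = differentiable_atlasD(1)[OF A2 c2(1) c2(1)]
  have l: "((\<lambda>z. transition c1 d1 (left_part z)) has_derivative
      (\<lambda>v. frechet_derivative (transition c1 d1) (at (snd c1 p)) (left_part v))) (at ?x)"
    by (rule has_derivative_compose[OF bounded_linear.has_derivative[OF bounded_linear_parts(1)]])
      (use transition_derivative[OF A1 c1(1) d1(1) c1(2) d1(2)] in auto)
  have r: "((\<lambda>z. transition c2 d2 (right_part z)) has_derivative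
      (\<lambda>v. frechet_derivative (transition c2 d2) (at (snd c2 q)) (right_part v))) (at ?x)"
    by (rule has_derivative_compose[OF bounded_linear.has_derivative[OF bounded_linear_parts(2)]])
      (use transition_derivative[OF A2 c2(1) d2(1) c2(2) d2(2)] in auto)
  let ?S = "snd (prod_chart c1 c2) ` (fst c1 \<times> fst c2)"
  show ?thesis
  proof (rule has_derivative_transform_within_open[OF has_derivative_join_vec[OF l r]])
    show "open ?S"
      using differentiable_atlasD(2)[OF A1 c1(1) c1(1)] differentiable_atlasD(2)[OF A2 c2(1) c2(1)]
      by (intro open_prod_chart_image) auto
    show "?x \<in> ?S" using c1 c2 by (force simp: image_iff)
    fix x assume "x \<in> ?S"
    then obtain a b where ab: "a \<in> fst c1" "b \<in> fst c2" "x = snd (prod_chart c1 c2) (a, b)"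
      by auto
    then have "transition (prod_chart c1 c2) (prod_chart d1 d2) x = snd (prod_chart d1 d2) (a, b)"
      using transition_chart[OF inj_on_prod_chart[OF inj1 inj2], of "(a, b)"] by simp
    then show "join_vec (transition c1 d1 (left_part x)) (transition c2 d2 (right_part x)) =
        transition (prod_chart c1 c2) (prod_chart d1 d2) x"
      using ab by (simp add: transition_chart inj1 inj2)
  qed
qed

lemma differentiable_prod_atlas:
  assumes A1: "differentiable_atlas A1" and A2: "differentiable_atlas A2"
  shows "differentiable_atlas (prod_atlas A1 A2)"
  unfolding differentiable_atlas_def
proof (intro conjI ballI)
  fix c assume "c \<in> prod_atlas A1 A2"
  then obtain c1 c2 where c: "c = prod_chart c1 c2" "c1 \<in> A1" "c2 \<in> A2" by (rule prod_atlasE)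
  show "inj_on (snd c) (fst c)"
    unfolding c(1) by (rule inj_on_prod_chart[OF differentiable_atlasD(1)[OF A1 c(2) c(2)]
          differentiable_atlasD(1)[OF A2 c(3) c(3)]])
  fix d assume "d \<in> prod_atlas A1 A2"
  then obtain d1 d2 where d: "d = prod_chart d1 d2" "d1 \<in> A1" "d2 \<in> A2" by (rule prod_atlasE)
  have "fst c \<inter> fst d = (fst c1 \<inter> fst d1) \<times> (fst c2 \<inter> fst d2)"
    using c d by auto
  then show "open (snd c ` (fst c \<inter> fst d))"
    using open_prod_chart_image differentiable_atlasD(2) A1 A2 c d by metis
  fix p assume "p \<in> fst c \<inter> fst d"
  then show "transition c d differentiable at (snd c p)"
    using prod_transition_derivative[OF A1 A2 c(2) _ c(3) _ d(2) _ d(3)] c d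
    by (force simp: differentiable_def)
qed

lemma some_chart:
  assumes "c \<in> A" "p \<in> fst c"
  shows "some_chart A p \<in> A" "p \<in> fst (some_chart A p)"
  using someI[of "\<lambda>c. c \<in> A \<and> p \<in> fst c" c] assms unfolding some_chart_def by auto

text \<open>The differential of a projection is computed in a chart \<open>some_chart\<close> of the product, which
  is itself a product of charts \<open>d1\<close> and \<open>d2\<close>.  In these coordinates the projection followed by
  a chart \<open>d\<close> of the first factor is the transition from \<open>d1\<close> to \<open>d\<close> after \<open>left_part\<close>, and the
  cocycle identity for \<open>c1\<close>, \<open>d1\<close>, \<open>d\<close> removes \<open>d1\<close> again.\<close>

lemma tproj_tangent:
  assumes A1: "differentiable_atlas A1" and A2: "differentiable_atlas A2"
    and c1: "c1 \<in> A1" "p \<in> fst c1" and c2: "c2 \<in> A2" "q \<in> fst c2"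
  shows "tproj1 A1 A2 (tangent (prod_atlas A1 A2) (prod_chart c1 c2) (p, q) z) =
           tangent A1 c1 p (left_part z)" (is "?T1")
    and "tproj2 A1 A2 (tangent (prod_atlas A1 A2) (prod_chart c1 c2) (p, q) z) =
           tangent A2 c2 q (right_part z)" (is "?T2")
proof -
  let ?P = "prod_atlas A1 A2" and ?c = "prod_chart c1 c2"
  have cP: "?c \<in> ?P" "(p, q) \<in> fst ?c" using c1 c2 by (auto intro: prod_chart_in_prod_atlas)
  obtain d1 d2 where d: "some_chart ?P (p, q) = prod_chart d1 d2" "d1 \<in> A1" "d2 \<in> A2"
    using some_chart(1)[OF cP] by (rule prod_atlasE)
  then have pq: "p \<in> fst d1" "q \<in> fst d2" using some_chart(2)[OF cP] by auto
  have dP: "prod_chart d1 d2 \<in> ?P" using d by (auto intro: prod_chart_in_prod_atlas)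
  note inj1 = differentiable_atlasD(1)[OF A1 d(2) d(2)]
  note inj2 = differentiable_atlasD(1)[OF A2 d(3) d(3)]
  let ?x = "join_vec (snd d1 p) (snd d2 q)"
  let ?z = "join_vec (frechet_derivative (transition c1 d1) (at (snd c1 p)) (left_part z))
                  (frechet_derivative (transition c2 d2) (at (snd c2 q)) (right_part z))"
  have comp: "snd (tangent ?P ?c (p, q) z) (prod_chart d1 d2) = ?z"
    using dP pq frechet_derivative_at[OF prod_transition_derivative[OF A1 A2 c1 c2 d(2) pq(1)
        d(3) pq(2)], symmetric] by (simp add: tangent_def)
  let ?S = "snd (prod_chart d1 d2) ` (fst d1 \<times> fst d2)"
  have S: "open ?S" "?x \<in> ?S"
    using differentiable_atlasD(2)[OF A1 d(2) d(2)] differentiable_atlasD(2)[OF A2 d(3) d(3)] pq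
    by (intro open_prod_chart_image, auto) (force simp: image_iff)
  have inv: "\<exists>a b. a \<in> fst d1 \<and> b \<in> fst d2 \<and> x = join_vec (snd d1 a) (snd d2 b) \<and>
      chart_inv (prod_chart d1 d2) x = (a, b)" if "x \<in> ?S" for x
    using that chart_inv_chart[OF inj_on_prod_chart[OF inj1 inj2]] by fastforce
  have D1: "frechet_derivative (snd d \<circ> fst \<circ> chart_inv (prod_chart d1 d2)) (at ?x) ?z =
      frechet_derivative (transition c1 d) (at (snd c1 p)) (left_part z)"
    if "d \<in> A1" "p \<in> fst d" for d
  proof -
    have "((\<lambda>z. transition d1 d (left_part z)) has_derivative
        (\<lambda>v. frechet_derivative (transition d1 d) (at (snd d1 p)) (left_part v))) (at ?x)"
      by (rule has_derivative_compose[OF bounded_linear.has_derivative[OF bounded_linear_parts(1)]])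
        (use transition_derivative[OF A1 d(2) that(1) pq(1) that(2)] in auto)
    then have "((snd d \<circ> fst \<circ> chart_inv (prod_chart d1 d2)) has_derivative
        (\<lambda>v. frechet_derivative (transition d1 d) (at (snd d1 p)) (left_part v))) (at ?x)"
      by (rule has_derivative_transform_within_open[OF _ S])
        (use inv inj1 in \<open>fastforce simp: transition_chart\<close>)
    from frechet_derivative_at[OF this, symmetric]
    show ?thesis
      by (simp add: transition_derivative_cocycle[OF A1 c1 d(2) pq(1) that])
  qed
  have D2: "frechet_derivative (snd d \<circ> snd \<circ> chart_inv (prod_chart d1 d2)) (at ?x) ?z =
      frechet_derivative (transition c2 d) (at (snd c2 q)) (right_part z)"
    if "d \<in> A2" "q \<in> fst d" for d
  proof -
    have "((\<lambda>z. transition d2 d (right_part z)) has_derivative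
        (\<lambda>v. frechet_derivative (transition d2 d) (at (snd d2 q)) (right_part v))) (at ?x)"
      by (rule has_derivative_compose[OF bounded_linear.has_derivative[OF bounded_linear_parts(2)]])
        (use transition_derivative[OF A2 d(3) that(1) pq(2) that(2)] in auto)
    then have "((snd d \<circ> snd \<circ> chart_inv (prod_chart d1 d2)) has_derivative
        (\<lambda>v. frechet_derivative (transition d2 d) (at (snd d2 q)) (right_part v))) (at ?x)"
      by (rule has_derivative_transform_within_open[OF _ S])
        (use inv inj2 in \<open>fastforce simp: transition_chart\<close>)
    from frechet_derivative_at[OF this, symmetric]
    show ?thesis
      by (simp add: transition_derivative_cocycle[OF A2 c2 d(3) pq(2) that])
  qed
  show ?T1 unfolding tproj1_def tangent_map_def fst_tangent d(1) Let_def comp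
    by (simp add: tangent_def D1 cong: if_cong)
  show ?T2 unfolding tproj2_def tangent_map_def fst_tangent d(1) Let_def comp
    by (simp add: tangent_def D2 cong: if_cong)
qed

lemma prod_slit_bundle_in_charts:
  assumes A1: "differentiable_atlas A1" and A2: "differentiable_atlas A2"
    and w: "w \<in> prod_slit_bundle A1 A2"
    and c: "c1 \<in> A1" "c2 \<in> A2" "fst w \<in> fst c1 \<times> fst c2"
  obtains p q z where "p \<in> fst c1" "q \<in> fst c2" "left_part z \<noteq> 0" "right_part z \<noteq> 0"
    "w = tangent (prod_atlas A1 A2) (prod_chart c1 c2) (p, q) z"
proof -
  obtain p q where pq: "fst w = (p, q)" "p \<in> fst c1" "q \<in> fst c2" using c by auto
  let ?z = "snd w (prod_chart c1 c2)"
  have w': "w = tangent (prod_atlas A1 A2) (prod_chart c1 c2) (p, q) ?z"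
    using tangent_bundle_in_chart[OF differentiable_prod_atlas[OF A1 A2] _
        prod_chart_in_prod_atlas[OF c(1,2)], of w] w c pq
    unfolding prod_slit_bundle_def by auto
  have "tangent A1 c1 p (left_part ?z) \<in> slit_bundle A1"
    "tangent A2 c2 q (right_part ?z) \<in> slit_bundle A2"
    using w tproj_tangent[OF A1 A2 c(1) pq(2) c(2) pq(3), of ?z] w'
    unfolding prod_slit_bundle_def by auto
  then have "left_part ?z \<noteq> 0" "right_part ?z \<noteq> 0"
    by (simp_all add: tangent_in_slit_bundle_iff[OF A1 c(1) pq(2)]
        tangent_in_slit_bundle_iff[OF A2 c(2) pq(3)])
  with that pq w' show thesis by blast
qed

lemma tangent_in_prod_slit_bundle:
  assumes A1: "differentiable_atlas A1" and A2: "differentiable_atlas A2"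
    and c1: "c1 \<in> A1" "p \<in> fst c1" and c2: "c2 \<in> A2" "q \<in> fst c2"
    and z: "left_part z \<noteq> 0" "right_part z \<noteq> 0"
  shows "tangent (prod_atlas A1 A2) (prod_chart c1 c2) (p, q) z \<in> prod_slit_bundle A1 A2"
proof -
  have "(p, q) \<in> fst (prod_chart c1 c2)" using c1 c2 by simp
  then have "tangent (prod_atlas A1 A2) (prod_chart c1 c2) (p, q) z
      \<in> tangent_bundle (prod_atlas A1 A2)"
    using prod_chart_in_prod_atlas[OF c1(1) c2(1)] unfolding tangent_bundle_def by blast
  then show ?thesis
    using z unfolding prod_slit_bundle_def
    by (simp add: tproj_tangent[OF A1 A2 c1 c2] tangent_in_slit_bundle_iff[OF A1 c1]
        tangent_in_slit_bundle_iff[OF A2 c2])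
qed

section \<open>Hessian matrices of split sums\<close>

text \<open>Exactly the regularity that is needed to pull constant factors and summands through the
  iterated derivatives in \<open>hessian_matrix\<close>.  The origin is excluded because the square of a
  Finslerian metric need not be twice differentiable there.\<close>

definition twice_partially_differentiable :: "(real ^ 'n::finite \<Rightarrow> real) \<Rightarrow> bool" where
  "twice_partially_differentiable h \<longleftrightarrow> (\<forall>z. z \<noteq> 0 \<longrightarrow> (\<forall>i.
     (\<lambda>t. h (z + t *\<^sub>R axis i 1)) field_differentiable (at 0) \<and>
     (\<forall>j. (\<lambda>t. partial j h (z + t *\<^sub>R axis i 1)) field_differentiable (at 0))))"

lemma eventually_translate_nonzero:
  fixes y v :: "'a::real_normed_vector"
  assumes "y \<noteq> 0"
  shows "eventually (\<lambda>t. y + t *\<^sub>R v \<noteq> 0) (nhds (0::real))"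
proof -
  have "((\<lambda>t. y + t *\<^sub>R v) \<longlongrightarrow> y + 0 *\<^sub>R v) (nhds (0::real))"
    by (intro tendsto_intros filterlim_ident)
  then show ?thesis
    using tendsto_imp_eventually_ne[of _ "y" _ 0] assms by simp
qed

text \<open>Partial derivatives of a section \<open>L x\<close> are Frechet derivatives of \<open>L\<close> in the vertical
  directions \<open>(0, e\<^sub>j)\<close>, so the smoothness of \<open>L\<close> on the product carries over to the section.\<close>

lemma smooth_section_square_twice_partially_differentiable:
  fixes L :: "real ^ 'n::finite \<Rightarrow> real ^ 'n \<Rightarrow> real"
  assumes L: "smooth_on (X \<times> (- {0})) (\<lambda>(x, y). L x y)" and x: "x \<in> X"
  shows "twice_partially_differentiable (\<lambda>z. (L x z)\<^sup>2)"
proof -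
  define G where "G = (\<lambda>(x, y). L x y)"
  define P where "P j z = frechet_derivative G (at (x, z)) (0, axis j 1)" for j z
  have line: "((\<lambda>t. (x, z + t *\<^sub>R axis i 1)) has_derivative (\<lambda>t. (0, t *\<^sub>R axis i 1))) (at (0::real))"
    for z :: "real ^ 'n" and i
    by (auto intro!: derivative_eq_intros)
  have D: "((\<lambda>t. g (x, z + t *\<^sub>R axis i 1)) has_real_derivative
      frechet_derivative g (at (x, z)) (0, axis i 1)) (at 0)"
    if "g differentiable (at (x, z))" for g :: "_ \<Rightarrow> real" and z :: "real ^ 'n" and i
  proof -
    have g: "(g has_derivative frechet_derivative g (at (x, z))) (at (x, z))"
      using that frechet_derivative_works by blast
    have *: "frechet_derivative g (at (x, z)) (0, t *\<^sub>R axis i 1) =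
        t * frechet_derivative g (at (x, z)) (0, axis i 1)" for t
      using linear_scale[OF has_derivative_linear[OF g], of t "(0, axis i 1)"] by simp
    have "((\<lambda>t. g (x, z + t *\<^sub>R axis i 1)) has_derivative
        (\<lambda>t. frechet_derivative g (at (x, z)) (0, t *\<^sub>R axis i 1))) (at 0)"
      using has_derivative_compose[OF line[of z i], of g "frechet_derivative g (at (x, z))"] g
      by simp
    then show ?thesis
      unfolding * has_field_derivative_def by (simp add: mult_commute_abs)
  qed
  have L1: "((\<lambda>t. L x (z + t *\<^sub>R axis i 1)) has_real_derivative P i z) (at 0)"
    if "z \<noteq> 0" for z i
    using D[of G z i] smooth_on_imp_differentiable[OF L, of "(x, z)"] that x
    by (simp add: G_def P_def)
  have sq: "((\<lambda>t. (L x (z + t *\<^sub>R axis i 1))\<^sup>2) has_real_derivative 2 * L x z * P i z) (at 0)"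
    if "z \<noteq> 0" for z i
    using L1[OF that, of i] by (auto intro!: derivative_eq_intros)
  have part: "partial j (\<lambda>z. (L x z)\<^sup>2) z = 2 * L x z * P j z" if "z \<noteq> 0" for z j
    unfolding partial_def by (rule DERIV_imp_deriv[OF sq[OF that]])
  have P1: "(\<lambda>t. P j (z + t *\<^sub>R axis i 1)) field_differentiable (at 0)" if "z \<noteq> 0" for z i j
    using D[OF smooth_on_frechet_derivative_differentiable[OF L, of "(x, z)" "(0, axis j 1)"]]
      that x unfolding field_differentiable_def G_def P_def by auto
  show ?thesis
    unfolding twice_partially_differentiable_def
  proof (intro allI impI conjI)
    fix z :: "real ^ 'n" and i assume z: "z \<noteq> 0"
    show "(\<lambda>t. (L x (z + t *\<^sub>R axis i 1))\<^sup>2) field_differentiable at 0"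
      using sq[OF z] unfolding field_differentiable_def by blast
    fix j
    have ev: "eventually (\<lambda>t. 2 * L x (z + t *\<^sub>R axis i 1) * P j (z + t *\<^sub>R axis i 1) =
        partial j (\<lambda>z. (L x z)\<^sup>2) (z + t *\<^sub>R axis i 1)) (nhds (0::real))"
      using eventually_translate_nonzero[OF z, of "axis i 1"]
      by eventually_elim (simp add: part)
    have "(\<lambda>t. L x (z + t *\<^sub>R axis i 1)) field_differentiable (at 0)"
      using L1[OF z] unfolding field_differentiable_def by blast
    then have "(\<lambda>t. 2 * L x (z + t *\<^sub>R axis i 1) * P j (z + t *\<^sub>R axis i 1))
        field_differentiable (at 0)"
      using P1[OF z] by (intro field_differentiable_mult field_differentiable_const)
    then show "(\<lambda>t. partial j (\<lambda>z. (L x z)\<^sup>2) (z + t *\<^sub>R axis i 1)) field_differentiable (at 0)"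
      unfolding field_differentiable_def using DERIV_cong_ev[OF refl ev refl] by blast
  qed
qed

lemma deriv_affine:
  fixes g :: "real \<Rightarrow> real"
  assumes "g field_differentiable (at x)"
  shows "deriv (\<lambda>t. a * g t + b) x = a * deriv g x" "deriv (\<lambda>t. b + a * g t) x = a * deriv g x"
proof -
  have "(g has_real_derivative deriv g x) (at x)"
    using assms by (simp add: field_differentiable_derivI)
  then show "deriv (\<lambda>t. a * g t + b) x = a * deriv g x" "deriv (\<lambda>t. b + a * g t) x = a * deriv g x"
    by (auto intro!: DERIV_imp_deriv derivative_eq_intros)
qed

lemma partial_split_sum:
  assumes h1: "twice_partially_differentiable h1" and h2: "twice_partially_differentiable h2"
    and z: "left_part z \<noteq> 0" "right_part z \<noteq> 0"
  shows "partial (Inl i) (\<lambda>z. a * h1 (left_part z) + b * h2 (right_part z)) z =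
           a * partial i h1 (left_part z)"
    and "partial (Inr j) (\<lambda>z. a * h1 (left_part z) + b * h2 (right_part z)) z =
           b * partial j h2 (right_part z)"
  using h1 h2 z unfolding partial_def twice_partially_differentiable_def
  by (simp_all add: deriv_affine)

lemma deriv_scale:
  fixes g :: "real \<Rightarrow> real"
  shows "g field_differentiable (at x) \<Longrightarrow> deriv (\<lambda>t. a * g t) x = a * deriv g x"
  using deriv_affine(1)[of g x a 0] by simp

text \<open>The formula for the first partial derivative holds only where both parts are nonzero, but
  this is an open condition, so the formula may be differentiated once more along each axis.
  The mixed derivatives vanish since the inner derivative does not depend on the other part.\<close>

lemma partial_partial_split_sum:
  fixes h1 :: "real ^ 'm::finite \<Rightarrow> real" and h2 :: "real ^ 'n::finite \<Rightarrow> real"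
    and a b :: real
  assumes h1: "twice_partially_differentiable h1" and h2: "twice_partially_differentiable h2"
    and z: "left_part z \<noteq> 0" "right_part z \<noteq> 0"
  defines "H \<equiv> \<lambda>z. a * h1 (left_part z) + b * h2 (right_part z)"
  shows "partial (Inl i) (partial (Inl i') H) z = a * partial i (partial i' h1) (left_part z)"
    and "partial (Inr j) (partial (Inl i') H) z = 0"
    and "partial (Inl i) (partial (Inr j') H) z = 0"
    and "partial (Inr j) (partial (Inr j') H) z = b * partial j (partial j' h2) (right_part z)"
proof -
  have ev: "eventually (\<lambda>t. left_part (z + t *\<^sub>R v) \<noteq> 0 \<and> right_part (z + t *\<^sub>R v) \<noteq> 0) (nhds (0::real))"
    for v
    using eventually_translate_nonzero[OF z(1), of "left_part v"]
      eventually_translate_nonzero[OF z(2), of "right_part v"]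
    by eventually_elim simp
  have L: "partial k (partial (Inl i') H) z =
      deriv (\<lambda>t. a * partial i' h1 (left_part (z + t *\<^sub>R axis k 1))) 0" for k
    unfolding partial_def[of k]
  proof (rule deriv_cong_ev[OF _ refl])
    show "eventually (\<lambda>t. partial (Inl i') H (z + t *\<^sub>R axis k 1) =
        a * partial i' h1 (left_part (z + t *\<^sub>R axis k 1))) (nhds 0)"
      using ev[of "axis k 1"]
      by eventually_elim (unfold H_def, simp add: partial_split_sum[OF h1 h2])
  qed
  have R: "partial k (partial (Inr j') H) z =
      deriv (\<lambda>t. b * partial j' h2 (right_part (z + t *\<^sub>R axis k 1))) 0" for k
    unfolding partial_def[of k]
  proof (rule deriv_cong_ev[OF _ refl])
    show "eventually (\<lambda>t. partial (Inr j') H (z + t *\<^sub>R axis k 1) =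
        b * partial j' h2 (right_part (z + t *\<^sub>R axis k 1))) (nhds 0)"
      using ev[of "axis k 1"]
      by eventually_elim (unfold H_def, simp add: partial_split_sum[OF h1 h2])
  qed
  show "partial (Inl i) (partial (Inl i') H) z = a * partial i (partial i' h1) (left_part z)"
    unfolding L using h1 z unfolding twice_partially_differentiable_def
    by (simp add: deriv_scale partial_def[of i])
  show "partial (Inr j) (partial (Inr j') H) z = b * partial j (partial j' h2) (right_part z)"
    unfolding R using h2 z unfolding twice_partially_differentiable_def
    by (simp add: deriv_scale partial_def[of j])
  show "partial (Inr j) (partial (Inl i') H) z = 0" unfolding L by simp
  show "partial (Inl i) (partial (Inr j') H) z = 0" unfolding R by simp
qed

section \<open>The Hessian matrix of a convolution Finslerian metric\<close>

definition block_diagonal ::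
  "real ^ 'm::finite ^ 'm \<Rightarrow> real ^ 'n::finite ^ 'n \<Rightarrow> real ^ ('m + 'n) ^ ('m + 'n)" where
  "block_diagonal B C = (\<chi> k l. case k of
      Inl a \<Rightarrow> (case l of Inl b \<Rightarrow> B $ a $ b | Inr n \<Rightarrow> 0)
    | Inr m \<Rightarrow> (case l of Inl b \<Rightarrow> 0 | Inr n \<Rightarrow> C $ m $ n))"

lemma block_diagonal_eq_iff:
  "block_diagonal B C = block_diagonal B' C' \<longleftrightarrow> B = B' \<and> C = C'"
proof
  assume *: "block_diagonal B C = block_diagonal B' C'"
  have "B $ a $ b = B' $ a $ b" "C $ m $ n = C' $ m $ n" for a b m n
    using arg_cong[OF *, of "\<lambda>D. D $ Inl a $ Inl b"] arg_cong[OF *, of "\<lambda>D. D $ Inr m $ Inr n"]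
    by (simp_all add: block_diagonal_def)
  then show "B = B' \<and> C = C'" by (simp add: vec_eq_iff)
qed simp

text \<open>Symmetry equates the upper right block of the associated matrix with the zero block.  It
  is assumed only over the slit bundle of the product, so the associated matrix is taken at a
  tangent vector over \<open>(p, q)\<close> with both parts nonzero.\<close>

lemma convolution_finsler_metric_partials:
  fixes A1 :: "('a, 'm::finite) chart set" and A2 :: "('b, 'n::finite) chart set"
  assumes A1: "differentiable_atlas A1" and A2: "differentiable_atlas A2"
    and conv: "convolution_finsler_metric A1 F1 f1 A2 F2 f2"
    and c1: "c1 \<in> A1" "p \<in> fst c1" and c2: "c2 \<in> A2" "q \<in> fst c2"
    and pos: "f1 p > 0" "f2 q > 0"
  shows "partial i (f1 \<circ> chart_inv c1) (snd c1 p) * partial j (f2 \<circ> chart_inv c2) (snd c2 q) = 0"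
proof -
  let ?z = "join_vec (axis i 1) (axis j 1)"
  let ?w = "tangent (prod_atlas A1 A2) (prod_chart c1 c2) (p, q) ?z"
  let ?B = "associated_matrix A1 F1 f1 A2 F2 f2 c1 c2 ?w"
  have "?w \<in> prod_slit_bundle A1 A2"
    by (rule tangent_in_prod_slit_bundle[OF A1 A2 c1 c2]) (auto simp: axis_eq_0_iff)
  then have "transpose ?B = ?B"
    using conv c1 c2 unfolding convolution_finsler_metric_def symmetric_matrix_def by auto
  from arg_cong[OF this, of "\<lambda>C. C $ Inr j $ Inl i"]
  have "?B $ Inl i $ Inr j = ?B $ Inr j $ Inl i"
    by (simp only: transpose_def vec_lambda_beta)
  then show ?thesis
    using pos unfolding associated_matrix_def Let_def tproj_tangent[OF A1 A2 c1 c2] by simp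
qed

text \<open>The square root in the definition of the convolution is harmless: without the mixed term
  its argument is a sum of squares.\<close>

lemma convolution_squared:
  fixes A1 :: "('a, 'm::finite) chart set" and A2 :: "('b, 'n::finite) chart set"
  assumes A1: "differentiable_atlas A1" and A2: "differentiable_atlas A2"
    and conv: "convolution_finsler_metric A1 F1 f1 A2 F2 f2"
    and c1: "c1 \<in> A1" "p \<in> fst c1" and c2: "c2 \<in> A2" "q \<in> fst c2"
    and pos: "f1 p > 0" "f2 q > 0"
  shows "(convolution A1 F1 f1 A2 F2 f2
            (tangent (prod_atlas A1 A2) (prod_chart c1 c2) (p, q) z))\<^sup>2 =
         (f2 q)\<^sup>2 * (F1 (tangent A1 c1 p (left_part z)))\<^sup>2 +
         (f1 p)\<^sup>2 * (F2 (tangent A2 c2 q (right_part z)))\<^sup>2"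
proof -
  \<comment> \<open>Every product of gradient components is a combination of the vanishing products of
    partial derivatives.\<close>
  have zero: "gradient A1 F1 f1 d1 (snd d1 p) y1 $ i * gradient A2 F2 f2 d2 (snd d2 q) y2 $ j = 0"
    if "d1 \<in> A1" "p \<in> fst d1" "d2 \<in> A2" "q \<in> fst d2" for d1 d2 y1 y2 i j
  proof -
    have "(m * partial k (f1 \<circ> chart_inv d1) (snd d1 p)) *
        (m' * partial l (f2 \<circ> chart_inv d2) (snd d2 q)) = 0" for m k m' l
      using convolution_finsler_metric_partials[OF A1 A2 conv that pos, of k l] by auto
    then show ?thesis by (simp only: gradient_def vec_lambda_beta sum_product sum.neutral_const)
  qed
  have "(a * b * gradient A1 F1 f1 (some_chart A1 p) (snd (some_chart A1 p) p) y1 $ i *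
      gradient A2 F2 f2 (some_chart A2 q) (snd (some_chart A2 q) q) y2 $ j) = 0" for a b y1 y2 i j
    using zero[OF some_chart[OF c1] some_chart[OF c2]] by (simp only: mult.assoc mult_zero_right)
  then show ?thesis
    unfolding convolution_def Let_def tproj_tangent[OF A1 A2 c1 c2] fst_tangent
    by (simp only: sum.neutral_const mult_zero_right add_0_right) (simp add: sum_nonneg)
qed

lemma hessian_matrix_convolution:
  fixes A1 :: "('a, 'm::finite) chart set" and A2 :: "('b, 'n::finite) chart set"
  assumes A1: "differentiable_atlas A1" and A2: "differentiable_atlas A2"
    and F1: "finsler_metric A1 F1" and F2: "finsler_metric A2 F2"
    and conv: "convolution_finsler_metric A1 F1 f1 A2 F2 f2"
    and c1: "c1 \<in> A1" "p \<in> fst c1" and c2: "c2 \<in> A2" "q \<in> fst c2"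
    and pos: "f1 p > 0" "f2 q > 0"
    and z: "left_part z \<noteq> 0" "right_part z \<noteq> 0"
  shows "hessian_matrix (prod_atlas A1 A2) (convolution A1 F1 f1 A2 F2 f2) (prod_chart c1 c2)
           (snd (prod_chart c1 c2) (p, q)) z =
         block_diagonal ((f2 q)\<^sup>2 *\<^sub>R hessian_matrix A1 F1 c1 (snd c1 p) (left_part z))
                        ((f1 p)\<^sup>2 *\<^sub>R hessian_matrix A2 F2 c2 (snd c2 q) (right_part z))"
proof -
  note inj1 = differentiable_atlasD(1)[OF A1 c1(1) c1(1)]
  note inj2 = differentiable_atlasD(1)[OF A2 c2(1) c2(1)]
  define h1 where "h1 = (\<lambda>y. (local_rep A1 F1 c1 (snd c1 p) y)\<^sup>2)"
  define h2 where "h2 = (\<lambda>y. (local_rep A2 F2 c2 (snd c2 q) y)\<^sup>2)"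
  have h: "twice_partially_differentiable h1" "twice_partially_differentiable h2"
    unfolding h1_def h2_def using F1 F2 c1 c2 unfolding finsler_metric_def
    by (auto intro!: smooth_section_square_twice_partially_differentiable)
  have "chart_inv (prod_chart c1 c2) (snd (prod_chart c1 c2) (p, q)) = (p, q)"
    using chart_inv_chart[OF inj_on_prod_chart[OF inj1 inj2], of "(p, q)"] c1 c2 by simp
  then have "(\<lambda>y. (local_rep (prod_atlas A1 A2) (convolution A1 F1 f1 A2 F2 f2) (prod_chart c1 c2)
      (snd (prod_chart c1 c2) (p, q)) y)\<^sup>2) =
      (\<lambda>y. (f2 q)\<^sup>2 * h1 (left_part y) + (f1 p)\<^sup>2 * h2 (right_part y))"
    using convolution_squared[OF A1 A2 conv c1 c2 pos] c1 c2
    by (simp add: local_rep_def h1_def h2_def chart_inv_chart inj1 inj2 del: prod_chart_simps(2))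
  then show ?thesis
    using partial_partial_split_sum[OF h z]
    by (auto simp: hessian_matrix_def block_diagonal_def vec_eq_iff h1_def[symmetric]
        h2_def[symmetric] simp del: prod_chart_simps(2) split: sum.split)
qed

section \<open>Locally Minkowskian convolutions\<close>

lemma locally_constant_imp_constant:
  assumes M: "connected_space M" "topspace M \<noteq> {}"
    and loc: "\<And>p. p \<in> topspace M \<Longrightarrow> \<exists>U. openin M U \<and> p \<in> U \<and> (\<forall>q\<in>U. f q = f p)"
  shows "\<exists>k. \<forall>p\<in>topspace M. f p = k"
proof -
  obtain p0 where p0: "p0 \<in> topspace M" using M by blast
  let ?S = "{p \<in> topspace M. f p = f p0}" and ?T = "{p \<in> topspace M. f p \<noteq> f p0}"
  have "openin M {p \<in> topspace M. f p \<in> V}" for V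
  proof (subst openin_subopen, intro ballI)
    fix p assume p: "p \<in> {p \<in> topspace M. f p \<in> V}"
    then obtain U where U: "openin M U" "p \<in> U" "\<forall>q\<in>U. f q = f p" using loc by blast
    have "f q \<in> V" if "q \<in> U" for q using bspec[OF U(3) that] p by simp
    then have "U \<subseteq> {p \<in> topspace M. f p \<in> V}" using openin_subset[OF U(1)] by blast
    with U show "\<exists>T. openin M T \<and> p \<in> T \<and> T \<subseteq> {p \<in> topspace M. f p \<in> V}" by blast
  qed
  from this[of "{f p0}"] this[of "- {f p0}"] have "openin M ?S" "openin M ?T" by simp_all
  moreover have "?S \<inter> ?T = {}" "topspace M \<subseteq> ?S \<union> ?T" by auto
  ultimately have "?S = {} \<or> ?T = {}"
    using M(1) unfolding connected_space_def by meson
  then show ?thesis using p0 by blast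
qed

lemma smooth_manifold_chart_domain:
  assumes "smooth_manifold M A" "c \<in> A"
  shows "openin M (fst c)" "fst c \<subseteq> topspace M"
  using assms openin_subset unfolding smooth_manifold_def is_chart_def by blast+

lemma hessian_matrix_nonzero:
  assumes A: "differentiable_atlas A" and F: "finsler_metric A F"
    and c: "c \<in> A" "p \<in> fst c" and y: "y \<noteq> 0"
  shows "hessian_matrix A F c (snd c p) y \<noteq> 0"
proof -
  have "tangent A c p y \<in> slit_bundle A"
    using tangent_in_slit_bundle_iff[OF A c] y by simp
  then have "positive_definite (hessian_matrix A F c (snd c p) y)"
    using F c tangent_components[OF A c, of y] unfolding finsler_metric_def
    by (metis fst_tangent)
  then have "y \<bullet> (hessian_matrix A F c (snd c p) y *v y) > 0"
    using y unfolding positive_definite_def by blast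
  then show ?thesis by auto
qed

text \<open>The Hessian matrix over a reference point \<open>p\<close> of the chart serves as the function of \<open>y\<close>
  alone; over the slit bundle only the components \<open>y \<noteq> 0\<close> occur.\<close>

lemma locally_minkowskian_in_chart:
  assumes A: "differentiable_atlas A"
    and loc: "\<And>p. p \<in> topspace M \<Longrightarrow> \<exists>c\<in>A. p \<in> fst c \<and>
       (\<forall>q\<in>fst c. \<forall>y. y \<noteq> 0 \<longrightarrow>
          hessian_matrix A F c (snd c q) y = hessian_matrix A F c (snd c p) y)"
  shows "locally_minkowskian M A (slit_bundle A) F"
  unfolding locally_minkowskian_def
proof
  fix p assume "p \<in> topspace M"
  then obtain c where c: "c \<in> A" "p \<in> fst c"
    and eq: "\<And>q y. q \<in> fst c \<Longrightarrow> y \<noteq> 0 \<Longrightarrow>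
      hessian_matrix A F c (snd c q) y = hessian_matrix A F c (snd c p) y"
    using loc by blast
  have "snd w c \<noteq> 0" if "w \<in> slit_bundle A" "fst w \<in> fst c" for w
    using tangent_bundle_in_chart[OF A _ c(1) that(2)] that
      tangent_in_slit_bundle_iff[OF A c(1) that(2), of "snd w c"]
    unfolding slit_bundle_def by force
  then have "\<forall>w\<in>slit_bundle A. fst w \<in> fst c \<longrightarrow>
      hessian_matrix A F c (snd c (fst w)) (snd w c) = hessian_matrix A F c (snd c p) (snd w c)"
    by (intro ballI impI eq)
  then show "\<exists>c\<in>A. p \<in> fst c \<and> (\<exists>g. \<forall>w\<in>slit_bundle A. fst w \<in> fst c \<longrightarrow>
      hessian_matrix A F c (snd c (fst w)) (snd w c) = g (snd w c))"
    using c by blast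
qed

lemma scaled_equal_nonzero:
  fixes B :: "'a::real_vector" and a b :: real
  assumes "a\<^sup>2 *\<^sub>R B = b\<^sup>2 *\<^sub>R B" "B \<noteq> 0" "a > 0" "b > 0"
  shows "a = b"
proof -
  have "a\<^sup>2 = b\<^sup>2" using assms(1,2) by (simp add: scaleR_right_imp_eq)
  then show ?thesis using assms(3,4) by (simp add: power2_eq_imp_eq)
qed

theorem theorem3p4:
  fixes M1 :: "'a topology" and A1 :: "('a, 'm::finite) chart set"
    and F1 :: "('a, 'm) tvector \<Rightarrow> real" and f1 :: "'a \<Rightarrow> real"
    and M2 :: "'b topology" and A2 :: "('b, 'n::finite) chart set"
    and F2 :: "('b, 'n) tvector \<Rightarrow> real" and f2 :: "'b \<Rightarrow> real"
  assumes "smooth_manifold M1 A1" and "smooth_manifold M2 A2"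
    and "finsler_metric A1 F1" and "finsler_metric A2 F2"
    and "smooth_function A1 f1" and "\<And>p. p \<in> topspace M1 \<Longrightarrow> f1 p > 0"
    and "smooth_function A2 f2" and "\<And>q. q \<in> topspace M2 \<Longrightarrow> f2 q > 0"
    and "convolution_finsler_metric A1 F1 f1 A2 F2 f2"
  shows "locally_minkowskian (prod_topology M1 M2) (prod_atlas A1 A2) (prod_slit_bundle A1 A2)
           (convolution A1 F1 f1 A2 F2 f2)
     \<longleftrightarrow> locally_minkowskian M1 A1 (slit_bundle A1) F1 \<and>
         locally_minkowskian M2 A2 (slit_bundle A2) F2 \<and>
         (\<exists>k. k \<noteq> 0 \<and> (\<forall>p\<in>topspace M1. f1 p = k)) \<and>
         (\<exists>k. k \<noteq> 0 \<and> (\<forall>q\<in>topspace M2. f2 q = k))"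
proof -
  note M1 = assms(1) and M2 = assms(2) and F1 = assms(3) and F2 = assms(4)
  note pos1 = assms(6) and pos2 = assms(8) and conv = assms(9)
  note A1 = smooth_manifold_imp_differentiable_atlas[OF M1]
  note A2 = smooth_manifold_imp_differentiable_atlas[OF M2]
  note sub1 = smooth_manifold_chart_domain[OF M1] and sub2 = smooth_manifold_chart_domain[OF M2]
  let ?P = "prod_atlas A1 A2" and ?F = "convolution A1 F1 f1 A2 F2 f2"
  let ?G1 = "\<lambda>c p y. hessian_matrix A1 F1 c (snd c p) y"
  let ?G2 = "\<lambda>c q y. hessian_matrix A2 F2 c (snd c q) y"
  have P: "differentiable_atlas ?P" by (rule differentiable_prod_atlas[OF A1 A2])
  have hess: "hessian_matrix ?P ?F (prod_chart c1 c2) (snd (prod_chart c1 c2) (p, q)) z =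
      block_diagonal ((f2 q)\<^sup>2 *\<^sub>R ?G1 c1 p (left_part z)) ((f1 p)\<^sup>2 *\<^sub>R ?G2 c2 q (right_part z))"
    if "c1 \<in> A1" "p \<in> fst c1" "c2 \<in> A2" "q \<in> fst c2" "left_part z \<noteq> 0" "right_part z \<noteq> 0"
    for c1 p c2 q z
  proof (rule hessian_matrix_convolution[OF A1 A2 F1 F2 conv that(1-4) _ _ that(5,6)])
    show "f1 p > 0" "f2 q > 0"
      using pos1 pos2 sub1(2)[OF that(1)] sub2(2)[OF that(3)] that(2,4) by blast+
  qed
  have comp: "snd (tangent ?P (prod_chart c1 c2) (p, q) z) (prod_chart c1 c2) = z"
    if "c1 \<in> A1" "p \<in> fst c1" "c2 \<in> A2" "q \<in> fst c2" for c1 p c2 q z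
    using that by (intro tangent_components[OF P] prod_chart_in_prod_atlas) auto
  show ?thesis (is "?L \<longleftrightarrow> ?R")
  proof
    assume L: ?L
    \<comment> \<open>All consequences are local.  The neighbourhood is the domain of a product chart, so the
      two base points can be moved independently of each other.\<close>
    have local: "\<exists>c1\<in>A1. \<exists>c2\<in>A2. p0 \<in> fst c1 \<and> q0 \<in> fst c2 \<and>
        (\<forall>p\<in>fst c1. f1 p = f1 p0) \<and> (\<forall>q\<in>fst c2. f2 q = f2 q0) \<and>
        (\<forall>p\<in>fst c1. \<forall>y. y \<noteq> 0 \<longrightarrow> ?G1 c1 p y = ?G1 c1 p0 y) \<and>
        (\<forall>q\<in>fst c2. \<forall>y. y \<noteq> 0 \<longrightarrow> ?G2 c2 q y = ?G2 c2 q0 y)"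
      if "p0 \<in> topspace M1" "q0 \<in> topspace M2" for p0 q0
    proof -
      have "(p0, q0) \<in> topspace (prod_topology M1 M2)" using that by simp
      then obtain c g where c: "c \<in> ?P" "(p0, q0) \<in> fst c"
        and g: "\<And>w. w \<in> prod_slit_bundle A1 A2 \<Longrightarrow> fst w \<in> fst c \<Longrightarrow>
               hessian_matrix ?P ?F c (snd c (fst w)) (snd w c) = g (snd w c)"
        using L unfolding locally_minkowskian_def by blast
      obtain c1 c2 where c': "c = prod_chart c1 c2" "c1 \<in> A1" "c2 \<in> A2"
        using c(1) by (rule prod_atlasE)
      have p0: "p0 \<in> fst c1" and q0: "q0 \<in> fst c2" using c(2) c'(1) by auto
      have hess_g: "block_diagonal ((f2 q)\<^sup>2 *\<^sub>R ?G1 c1 p y1) ((f1 p)\<^sup>2 *\<^sub>R ?G2 c2 q y2) =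
          g (join_vec y1 y2)"
        if "p \<in> fst c1" "q \<in> fst c2" "y1 \<noteq> 0" "y2 \<noteq> 0" for p q y1 y2
      proof -
        let ?w = "tangent ?P c (p, q) (join_vec y1 y2)"
        have "?w \<in> prod_slit_bundle A1 A2" unfolding c'(1)
          using that c' by (intro tangent_in_prod_slit_bundle[OF A1 A2]) auto
        from g[OF this] show ?thesis
          using that c' hess[of c1 p c2 q "join_vec y1 y2"] comp by simp
      qed
      have blocks: "(f2 q)\<^sup>2 *\<^sub>R ?G1 c1 p y1 = (f2 q0)\<^sup>2 *\<^sub>R ?G1 c1 p0 y1"
        "(f1 p)\<^sup>2 *\<^sub>R ?G2 c2 q y2 = (f1 p0)\<^sup>2 *\<^sub>R ?G2 c2 q0 y2"
        if "p \<in> fst c1" "q \<in> fst c2" "y1 \<noteq> 0" "y2 \<noteq> 0" for p q y1 y2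
        using hess_g[OF that] hess_g[OF p0 q0 that(3,4)] by (metis block_diagonal_eq_iff)+
      \<comment> \<open>Any nonzero vectors serve to compare the blocks over different base points.\<close>
      define e1 :: "real ^ 'm" where "e1 = axis undefined 1"
      define e2 :: "real ^ 'n" where "e2 = axis undefined 1"
      have e: "e1 \<noteq> 0" "e2 \<noteq> 0" by (simp_all add: e1_def e2_def axis_eq_0_iff)
      have f2c: "f2 q = f2 q0" if "q \<in> fst c2" for q
        using blocks(1)[OF p0 that e] hessian_matrix_nonzero[OF A1 F1 c'(2) p0 e(1)]
          pos2 sub2[OF c'(3)] that q0 by (intro scaled_equal_nonzero) auto
      have f1c: "f1 p = f1 p0" if "p \<in> fst c1" for p
        using blocks(2)[OF that q0 e] hessian_matrix_nonzero[OF A2 F2 c'(3) q0 e(2)]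
          pos1 sub1[OF c'(2)] that p0 by (intro scaled_equal_nonzero) auto
      have "f1 p0 > 0" "f2 q0 > 0" using pos1 pos2 \<open>p0 \<in> topspace M1\<close> \<open>q0 \<in> topspace M2\<close> by auto
      then have "?G1 c1 p y1 = ?G1 c1 p0 y1" if "p \<in> fst c1" "y1 \<noteq> 0" for p y1
        using blocks(1)[OF that(1) q0 that(2) e(2)] by simp
      moreover have "?G2 c2 q y2 = ?G2 c2 q0 y2" if "q \<in> fst c2" "y2 \<noteq> 0" for q y2
        using blocks(2)[OF p0 that(1) e(1) that(2)] \<open>f1 p0 > 0\<close> by simp
      ultimately show ?thesis using c' p0 q0 f1c f2c by blast
    qed
    obtain p1 q1 where p1: "p1 \<in> topspace M1" and q1: "q1 \<in> topspace M2"
      using M1 M2 unfolding smooth_manifold_def by blast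
    have con1: "connected_space M1" "topspace M1 \<noteq> {}"
      and con2: "connected_space M2" "topspace M2 \<noteq> {}"
      using M1 M2 unfolding smooth_manifold_def by blast+
    have "locally_minkowskian M1 A1 (slit_bundle A1) F1"
      by (rule locally_minkowskian_in_chart[OF A1]) (use local q1 in blast)
    moreover have "locally_minkowskian M2 A2 (slit_bundle A2) F2"
      by (rule locally_minkowskian_in_chart[OF A2]) (use local p1 in blast)
    moreover have "\<exists>k. \<forall>p\<in>topspace M1. f1 p = k"
    proof (rule locally_constant_imp_constant[OF con1])
      fix p assume "p \<in> topspace M1"
      from local[OF this q1] obtain c where "c \<in> A1" "p \<in> fst c" "\<forall>u\<in>fst c. f1 u = f1 p"
        by blast
      then show "\<exists>U. openin M1 U \<and> p \<in> U \<and> (\<forall>u\<in>U. f1 u = f1 p)"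
        using sub1(1) by blast
    qed
    moreover have "\<exists>k. \<forall>q\<in>topspace M2. f2 q = k"
    proof (rule locally_constant_imp_constant[OF con2])
      fix q assume "q \<in> topspace M2"
      from local[OF p1 this] obtain c where "c \<in> A2" "q \<in> fst c" "\<forall>u\<in>fst c. f2 u = f2 q"
        by blast
      then show "\<exists>U. openin M2 U \<and> q \<in> U \<and> (\<forall>u\<in>U. f2 u = f2 q)"
        using sub2(1) by blast
    qed
    ultimately obtain k1 k2 where "\<forall>p\<in>topspace M1. f1 p = k1" "\<forall>q\<in>topspace M2. f2 q = k2"
      and min: "locally_minkowskian M1 A1 (slit_bundle A1) F1"
        "locally_minkowskian M2 A2 (slit_bundle A2) F2"
      by blast
    moreover from this have "k1 \<noteq> 0" "k2 \<noteq> 0" using pos1[OF p1] pos2[OF q1] p1 q1 by auto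
    ultimately show ?R by blast
  next
    assume R: ?R
    then obtain k1 k2 where k: "\<And>p. p \<in> topspace M1 \<Longrightarrow> f1 p = k1"
      "\<And>q. q \<in> topspace M2 \<Longrightarrow> f2 q = k2" by blast
    show ?L unfolding locally_minkowskian_def
    proof
      fix u assume "u \<in> topspace (prod_topology M1 M2)"
      then obtain p0 q0 where u: "u = (p0, q0)" "p0 \<in> topspace M1" "q0 \<in> topspace M2" by auto
      obtain c1 g1 where c1: "c1 \<in> A1" "p0 \<in> fst c1"
        and g1: "\<And>w. w \<in> slit_bundle A1 \<Longrightarrow> fst w \<in> fst c1 \<Longrightarrow>
               ?G1 c1 (fst w) (snd w c1) = g1 (snd w c1)"
        using R u unfolding locally_minkowskian_def by metis
      obtain c2 g2 where c2: "c2 \<in> A2" "q0 \<in> fst c2"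
        and g2: "\<And>w. w \<in> slit_bundle A2 \<Longrightarrow> fst w \<in> fst c2 \<Longrightarrow>
               ?G2 c2 (fst w) (snd w c2) = g2 (snd w c2)"
        using R u unfolding locally_minkowskian_def by metis
      have G1: "?G1 c1 p y = g1 y" if "p \<in> fst c1" "y \<noteq> 0" for p y
        using g1[of "tangent A1 c1 p y"] that tangent_in_slit_bundle_iff[OF A1 c1(1) that(1)]
          tangent_components[OF A1 c1(1) that(1)] by simp
      have G2: "?G2 c2 q y = g2 y" if "q \<in> fst c2" "y \<noteq> 0" for q y
        using g2[of "tangent A2 c2 q y"] that tangent_in_slit_bundle_iff[OF A2 c2(1) that(1)]
          tangent_components[OF A2 c2(1) that(1)] by simp
      let ?c = "prod_chart c1 c2"
      let ?g = "\<lambda>z. block_diagonal (k2\<^sup>2 *\<^sub>R g1 (left_part z)) (k1\<^sup>2 *\<^sub>R g2 (right_part z))"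
      have "hessian_matrix ?P ?F ?c (snd ?c (fst w)) (snd w ?c) = ?g (snd w ?c)"
        if w: "w \<in> prod_slit_bundle A1 A2" "fst w \<in> fst ?c" for w
      proof -
        obtain p q z where pq: "p \<in> fst c1" "q \<in> fst c2"
          and z: "left_part z \<noteq> 0" "right_part z \<noteq> 0"
          and w': "w = tangent ?P ?c (p, q) z"
          using prod_slit_bundle_in_charts[OF A1 A2 w(1) c1(1) c2(1)] w(2) by auto
        have "f1 p = k1" "f2 q = k2"
          using k pq sub1(2)[OF c1(1)] sub2(2)[OF c2(1)] by blast+
        then show ?thesis
          unfolding w' comp[OF c1(1) pq(1) c2(1) pq(2)] fst_tangent
            hess[OF c1(1) pq(1) c2(1) pq(2) z] G1[OF pq(1) z(1)] G2[OF pq(2) z(2)] by simp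
      qed
      then show "\<exists>c\<in>?P. u \<in> fst c \<and> (\<exists>g. \<forall>w\<in>prod_slit_bundle A1 A2. fst w \<in> fst c \<longrightarrow>
          hessian_matrix ?P ?F c (snd c (fst w)) (snd w c) = g (snd w c))"
        using c1 c2 u by (intro bexI[of _ ?c] conjI exI[of _ ?g])
          (auto intro: prod_chart_in_prod_atlas)
    qed
  qed
qed

end
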